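(* Let $(A,\cdot,[\cdot,\cdot],\alpha_r,\beta_r)$ be a factorizable Gel'fand-Dorfman bialgebra with $I_G=r_+^G-r_-^G$, and let $\theta\in\mathbf k$. Then $(A,\cdot,[\cdot,\cdot],\mathfrak B,(\cdot,\cdot)^{I_G})$ is a quadratic Rota-Baxter Gel'fand-Dorfman algebra of weight $\theta$, where the linear map $\mathfrak B:A\to A$ and the bilinear form $(\cdot,\cdot)^{I_G}$ are defined by $$\mathfrak B=\theta\, r_-^G\circ I_G^{-1},\qquad (a,b)^{I_G}=\langle I_G^{-1}a,b\rangle,\qquad\forall a,b\in A.$$ Conversely, let $(A,\cdot,[\cdot,\cdot],\mathfrak B,(\cdot,\cdot))$ be a quadratic Rota-Baxter Gel'fand-Dorfman algebra of weight $\theta$ with $0\neq\theta\in\mathbf k$. Let $I_G:A^*\to A$ be the induced vector space isomorphism given by $(a,b)=\langle I_G^{-1}a,b\rangle$ for all $a,b\in A$. Then $$r=\sum_{j=1}^n\frac1\theta\,e_j\otimes(\mathfrak B+\theta\,\mathrm{id})I_G(e_j^* )\in A\otimes A$$ is a solution of the Gel'fand-Dorfman Yang-Baxter equation in $(A,\cdot,[\cdot,\cdot])$, where $\{e_j\}_{j=1}^n$ is a basis of $A$ and $\{e_j^*\}_{j=1}^n$ is the dual basis of $A^*$. Thus there is a factorizable Gel'fand-Dorfman bialgebra $(A,\cdot,[\cdot,\cdot],\alpha_r,\beta_r)$.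
   Context: $\mathbf k$ is a field of characteristic zero; vector spaces are finite-dimensional; tensors are over $\mathbf k$; $\tau$ is the flip. A Novikov algebra $(A,\cdot)$ satisfies $(a\cdot b)\cdot c-a\cdot(b\cdot c)=(b\cdot a)\cdot c-b\cdot(a\cdot c)$ and $(a\cdot b)\cdot c=(a\cdot c)\cdot b$. A Gel'fand-Dorfman algebra (GDA) $(A,\cdot,[\cdot,\cdot])$ is a Novikov algebra $(A,\cdot)$ and a Lie algebra $(A,[\cdot,\cdot])$ with $[a\cdot b,c]-[a\cdot c,b]+[a,b]\cdot c-[a,c]\cdot b-a\cdot[b,c]=0$. An isomorphism of GDAs is a linear isomorphism preserving both operations. $L(a)b=a\cdot b$, $R(a)b=b\cdot a$, $\mathrm{ad}(a)b=[a,b]$, and for $f=L,R,\mathrm{ad}$ and $x\in A^*$, $\langle f^*(a)x,b\rangle=-\langle x,f(a)b\rangle$. For $r=\sum_i a_i\otimes b_i\in A\otimes A$ put $\alpha_r(a)=-(L(a)\otimes\mathrm{id}+\mathrm{id}\otimes(L+R)(a))r$, $\beta_r(a)=(\mathrm{ad}(a)\otimes\mathrm{id}+\mathrm{id}\otimes\mathrm{ad}(a))r$, $r_+^G(x)=\sum_i\langle x,a_i\rangle b_i$, $r_-^G(x)=-\sum_i\langle x,b_i\rangle a_i$ for $x\in A^*$. The Gel'fand-Dorfman Yang-Baxter equation (GDYBE) is $N(r)=C(r)=0$, where $N(r)=\sum_{i,j}(a_i\otimes a_j\otimes b_i\cdot b_j+a_i\otimes(b_i\cdot a_j+a_j\cdot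 b_i)\otimes b_j+a_i\cdot a_j\otimes b_j\otimes b_i)$, $C(r)=\sum_{i,j}([a_i,a_j]\otimes b_i\otimes b_j+a_i\otimes[b_i,a_j]\otimes b_j+a_i\otimes a_j\otimes[b_i,b_j])$. The symmetric part of $r$ is $\mathrm{ad}$-invariant if $(\mathrm{ad}(a)\otimes\mathrm{id}+\mathrm{id}\otimes\mathrm{ad}(a))(r+\tau r)=0$, and $(L,R)$-invariant if $(L(a)\otimes\mathrm{id}+\mathrm{id}\otimes(L+R)(a))(r+\tau r)=0$, for all $a\in A$. If $r$ solves the GDYBE and its symmetric part is $\mathrm{ad}$-invariant and $(L,R)$-invariant, then $(A,\cdot,[\cdot,\cdot],\alpha_r,\beta_r)$ is a Gel'fand-Dorfman bialgebra, called quasi-triangular, and $A^*$ is a GDA with $x\cdot_r y=(L^*+R^* )(r_+^G(x))y-R^*(r_-^G(y))x$ and $[x,y]_r=\mathrm{ad}^*(r_+^G(x))y-\mathrm{ad}^*(r_-^G(y))x$. It is factorizable if moreover $I_G=r_+^G-r_-^G:(A^*,\cdot_r,[\cdot,\cdot]_r)\to(A,\cdot,[\cdot,\cdot])$ is an isomorphism of GDAs. A Rota-Baxter GDA of weight $\theta$ is a GDA with a linear map $\mathfrak B:A\to A$ satisfying $\mathfrak B(a)\ast\mathfrak B(b)=\mathfrak B(\mathfrak B(a)\ast b+a\ast\mathfrak B(b)+\theta a\ast b)$ for both $\ast=\cdot$ and $\ast=[\cdot,\cdot]$. A quadratic GDA is a GDA with a non-degenerate symmetric bilinear form satisfying $([a,b],c)=(a,[b,c])$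 and $(a\cdot b,c)=-(b,a\cdot c+c\cdot a)$. A quadratic Rota-Baxter GDA of weight $\theta$ is a Rota-Baxter GDA of weight $\theta$ whose underlying GDA is quadratic, with $(\mathfrak B(a),b)+(a,\mathfrak B(b))+\theta(a,b)=0$.
   Formalization: "Factorizable" here requires I_G to be only a linear isomorphism A*→A between GDAs, not one preserving both operations: with preservation the converse fails (e.g. e·e=e, e·f=-2f, f·e=f, f·f=0, zero bracket, (e,f)=1, B minus the projection to e, θ=1). *)

theory Defs
  imports Complex_Main "HOL-Library.Function_Algebras"
begin

section \<open>Gel'fand-Dorfman algebras\<close>

text \<open>
  Algebras live on a subspace \<open>V\<close> of an ambient vector space (the whole type or a proper subspace),
  because the dual space \<open>A\<^sup>*\<close> is the subspace of linear functions inside the function space.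
\<close>

locale bilinear_product = vector_space scale
  for scale :: "'k::field \<Rightarrow> 'v::ab_group_add \<Rightarrow> 'v" +
  fixes V :: "'v set" and mult :: "'v \<Rightarrow> 'v \<Rightarrow> 'v"
  assumes carrier_subspace: "subspace V"
    and mult_closed: "\<lbrakk>a \<in> V; b \<in> V\<rbrakk> \<Longrightarrow> mult a b \<in> V"
    and mult_add_left: "\<lbrakk>a \<in> V; b \<in> V; c \<in> V\<rbrakk> \<Longrightarrow> mult (a + b) c = mult a c + mult b c"
    and mult_add_right: "\<lbrakk>a \<in> V; b \<in> V; c \<in> V\<rbrakk> \<Longrightarrow> mult a (b + c) = mult a b + mult a c"
    and mult_scale_left: "\<lbrakk>a \<in> V; b \<in> V\<rbrakk> \<Longrightarrow> mult (scale t a) b = scale t (mult a b)"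
    and mult_scale_right: "\<lbrakk>a \<in> V; b \<in> V\<rbrakk> \<Longrightarrow> mult a (scale t b) = scale t (mult a b)"

locale novikov_algebra = bilinear_product scale V mult
  for scale :: "'k::field \<Rightarrow> 'v::ab_group_add \<Rightarrow> 'v" and V mult +
  assumes left_symmetric: "\<lbrakk>a \<in> V; b \<in> V; c \<in> V\<rbrakk> \<Longrightarrow>
      mult (mult a b) c - mult a (mult b c) = mult (mult b a) c - mult b (mult a c)"
    and right_commutative: "\<lbrakk>a \<in> V; b \<in> V; c \<in> V\<rbrakk> \<Longrightarrow> mult (mult a b) c = mult (mult a c) b"

locale lie_algebra = bilinear_product scale V brk
  for scale :: "'k::field \<Rightarrow> 'v::ab_group_add \<Rightarrow> 'v" and V brk +
  assumes alternating: "a \<in> V \<Longrightarrow> brk a a = 0"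
    and jacobi: "\<lbrakk>a \<in> V; b \<in> V; c \<in> V\<rbrakk> \<Longrightarrow>
      brk a (brk b c) + brk b (brk c a) + brk c (brk a b) = 0"

locale gd_algebra =
  nov: novikov_algebra scale V mult + lie: lie_algebra scale V brk
  for scale :: "'k::field \<Rightarrow> 'v::ab_group_add \<Rightarrow> 'v" and V mult brk +
  assumes gd_compatible: "\<lbrakk>a \<in> V; b \<in> V; c \<in> V\<rbrakk> \<Longrightarrow>
      brk (mult a b) c - brk (mult a c) b + mult (brk a b) c - mult (brk a c) b
        - mult a (brk b c) = 0"

definition linear_iso_on ::
  "('k \<Rightarrow> 'v::ab_group_add \<Rightarrow> 'v) \<Rightarrow> 'v set \<Rightarrow> ('k \<Rightarrow> 'w::ab_group_add \<Rightarrow> 'w) \<Rightarrow> 'w set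
    \<Rightarrow> ('v \<Rightarrow> 'w) \<Rightarrow> bool" where
  "linear_iso_on scale1 V scale2 W f \<longleftrightarrow>
     bij_betw f V W \<and>
     (\<forall>x\<in>V. \<forall>y\<in>V. f (x + y) = f x + f y) \<and>
     (\<forall>c. \<forall>x\<in>V. f (scale1 c x) = scale2 c (f x))"

section \<open>Quadratic Rota-Baxter Gel'fand-Dorfman algebras\<close>

locale rota_baxter_gd_algebra = gd_algebra scale V mult brk
  for scale :: "'k::field \<Rightarrow> 'v::ab_group_add \<Rightarrow> 'v" and V mult brk +
  fixes \<theta> :: 'k and B :: "'v \<Rightarrow> 'v"
  assumes B_closed: "a \<in> V \<Longrightarrow> B a \<in> V"
    and B_add: "\<lbrakk>a \<in> V; b \<in> V\<rbrakk> \<Longrightarrow> B (a + b) = B a + B b"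
    and B_scale: "a \<in> V \<Longrightarrow> B (scale t a) = scale t (B a)"
    and rota_baxter_mult: "\<lbrakk>a \<in> V; b \<in> V\<rbrakk> \<Longrightarrow>
      mult (B a) (B b) = B (mult (B a) b + mult a (B b) + scale \<theta> (mult a b))"
    and rota_baxter_brk: "\<lbrakk>a \<in> V; b \<in> V\<rbrakk> \<Longrightarrow>
      brk (B a) (B b) = B (brk (B a) b + brk a (B b) + scale \<theta> (brk a b))"

locale quadratic_gd_algebra = gd_algebra scale V mult brk
  for scale :: "'k::field \<Rightarrow> 'v::ab_group_add \<Rightarrow> 'v" and V mult brk +
  fixes form :: "'v \<Rightarrow> 'v \<Rightarrow> 'k"
  assumes form_add: "\<lbrakk>a \<in> V; b \<in> V; c \<in> V\<rbrakk> \<Longrightarrow> form (a + b) c = form a c + form b c"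
    and form_scale: "\<lbrakk>a \<in> V; b \<in> V\<rbrakk> \<Longrightarrow> form (scale t a) b = t * form a b"
    and form_sym: "\<lbrakk>a \<in> V; b \<in> V\<rbrakk> \<Longrightarrow> form a b = form b a"
    and form_nondegenerate: "\<lbrakk>a \<in> V; \<forall>b\<in>V. form a b = 0\<rbrakk> \<Longrightarrow> a = 0"
    and form_brk: "\<lbrakk>a \<in> V; b \<in> V; c \<in> V\<rbrakk> \<Longrightarrow> form (brk a b) c = form a (brk b c)"
    and form_mult: "\<lbrakk>a \<in> V; b \<in> V; c \<in> V\<rbrakk> \<Longrightarrow>
      form (mult a b) c = - form b (mult a c + mult c a)"

locale quadratic_rota_baxter_gd_algebra =
  rota_baxter_gd_algebra scale V mult brk \<theta> B + quadratic_gd_algebra scale V mult brk form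
  for scale :: "'k::field \<Rightarrow> 'v::ab_group_add \<Rightarrow> 'v" and V mult brk \<theta> B form +
  assumes form_B: "\<lbrakk>a \<in> V; b \<in> V\<rbrakk> \<Longrightarrow> form (B a) b + form a (B b) + \<theta> * form a b = 0"

section \<open>Dual space and tensors\<close>

text \<open>From here on the algebra \<open>A\<close> is the whole type \<open>'a\<close>.\<close>

definition dual :: "('k::field \<Rightarrow> 'a::ab_group_add \<Rightarrow> 'a) \<Rightarrow> ('a \<Rightarrow> 'k) set" where
  "dual scale = {x. Vector_Spaces.linear scale (*) x}"

definition dual_scale :: "'k::field \<Rightarrow> ('a \<Rightarrow> 'k) \<Rightarrow> ('a \<Rightarrow> 'k)" where
  "dual_scale c x = (\<lambda>a. c * x a)"

definition dual_basis_vector ::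
  "('k::field \<Rightarrow> 'a::ab_group_add \<Rightarrow> 'a) \<Rightarrow> 'a set \<Rightarrow> 'a \<Rightarrow> ('a \<Rightarrow> 'k)" where
  "dual_basis_vector scale E e = (\<lambda>v. module.representation scale E v e)"

text \<open>
  For finite-dimensional \<open>A\<close>, the spaces \<open>A \<otimes> A\<close> and \<open>A \<otimes> A \<otimes> A\<close> are realised as bilinear and
  trilinear forms on \<open>A\<^sup>*\<close> (extended by \<open>0\<close> outside of \<open>A\<^sup>*\<close>): \<open>u \<otimes> v\<close> is the form sending \<open>(x, y)\<close>
  to \<open>\<langle>x, u\<rangle>\<langle>y, v\<rangle>\<close>. Sums and the zero tensor are the pointwise ones.
\<close>

definition tensor2 :: "('k::field \<Rightarrow> 'a::ab_group_add \<Rightarrow> 'a) \<Rightarrow> 'a \<Rightarrow> 'a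
    \<Rightarrow> (('a \<Rightarrow> 'k) \<Rightarrow> ('a \<Rightarrow> 'k) \<Rightarrow> 'k)" where
  "tensor2 scale u v =
     (\<lambda>x y. if x \<in> dual scale \<and> y \<in> dual scale then x u * y v else 0)"

definition tensor3 :: "('k::field \<Rightarrow> 'a::ab_group_add \<Rightarrow> 'a) \<Rightarrow> 'a \<Rightarrow> 'a \<Rightarrow> 'a
    \<Rightarrow> (('a \<Rightarrow> 'k) \<Rightarrow> ('a \<Rightarrow> 'k) \<Rightarrow> ('a \<Rightarrow> 'k) \<Rightarrow> 'k)" where
  "tensor3 scale u v w =
     (\<lambda>x y z. if x \<in> dual scale \<and> y \<in> dual scale \<and> z \<in> dual scale
              then x u * y v * z w else 0)"

section \<open>The Gel'fand-Dorfman Yang-Baxter equation\<close>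

text \<open>
  An element \<open>r = \<Sum>\<^sub>i a\<^sub>i \<otimes> b\<^sub>i\<close> of \<open>A \<otimes> A\<close> is given by the list of the pairs \<open>(a\<^sub>i, b\<^sub>i)\<close>. Everything
  defined below from such a list depends only on the tensor it represents. Adding tensors is
  appending lists, and the flip \<open>\<tau>\<close> swaps all pairs.
\<close>

type_synonym 'a tensor_rep = "('a \<times> 'a) list"

abbreviation symmetrized :: "'a tensor_rep \<Rightarrow> 'a tensor_rep" where
  "symmetrized r \<equiv> r @ map prod.swap r"

definition LR_action ::
  "('k::field \<Rightarrow> 'a::ab_group_add \<Rightarrow> 'a) \<Rightarrow> ('a \<Rightarrow> 'a \<Rightarrow> 'a) \<Rightarrow> 'a \<Rightarrow> 'a tensor_rep
    \<Rightarrow> (('a \<Rightarrow> 'k) \<Rightarrow> ('a \<Rightarrow> 'k) \<Rightarrow> 'k)" where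
  "LR_action scale mult a r =
     (\<Sum>(u, v)\<leftarrow>r. tensor2 scale (mult a u) v + tensor2 scale u (mult a v + mult v a))"

definition ad_action ::
  "('k::field \<Rightarrow> 'a::ab_group_add \<Rightarrow> 'a) \<Rightarrow> ('a \<Rightarrow> 'a \<Rightarrow> 'a) \<Rightarrow> 'a \<Rightarrow> 'a tensor_rep
    \<Rightarrow> (('a \<Rightarrow> 'k) \<Rightarrow> ('a \<Rightarrow> 'k) \<Rightarrow> 'k)" where
  "ad_action scale brk a r =
     (\<Sum>(u, v)\<leftarrow>r. tensor2 scale (brk a u) v + tensor2 scale u (brk a v))"

definition alpha_r ::
  "('k::field \<Rightarrow> 'a::ab_group_add \<Rightarrow> 'a) \<Rightarrow> ('a \<Rightarrow> 'a \<Rightarrow> 'a) \<Rightarrow> 'a tensor_rep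
    \<Rightarrow> 'a \<Rightarrow> (('a \<Rightarrow> 'k) \<Rightarrow> ('a \<Rightarrow> 'k) \<Rightarrow> 'k)" where
  "alpha_r scale mult r = (\<lambda>a. - LR_action scale mult a r)"

definition beta_r ::
  "('k::field \<Rightarrow> 'a::ab_group_add \<Rightarrow> 'a) \<Rightarrow> ('a \<Rightarrow> 'a \<Rightarrow> 'a) \<Rightarrow> 'a tensor_rep
    \<Rightarrow> 'a \<Rightarrow> (('a \<Rightarrow> 'k) \<Rightarrow> ('a \<Rightarrow> 'k) \<Rightarrow> 'k)" where
  "beta_r scale brk r = (\<lambda>a. ad_action scale brk a r)"

definition r_plus ::
  "('k::field \<Rightarrow> 'a::ab_group_add \<Rightarrow> 'a) \<Rightarrow> 'a tensor_rep \<Rightarrow> ('a \<Rightarrow> 'k) \<Rightarrow> 'a" where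
  "r_plus scale r x = (\<Sum>(a, b)\<leftarrow>r. scale (x a) b)"

definition r_minus ::
  "('k::field \<Rightarrow> 'a::ab_group_add \<Rightarrow> 'a) \<Rightarrow> 'a tensor_rep \<Rightarrow> ('a \<Rightarrow> 'k) \<Rightarrow> 'a" where
  "r_minus scale r x = - (\<Sum>(a, b)\<leftarrow>r. scale (x b) a)"

definition I_G ::
  "('k::field \<Rightarrow> 'a::ab_group_add \<Rightarrow> 'a) \<Rightarrow> 'a tensor_rep \<Rightarrow> ('a \<Rightarrow> 'k) \<Rightarrow> 'a" where
  "I_G scale r x = r_plus scale r x - r_minus scale r x"

definition N_tensor ::
  "('k::field \<Rightarrow> 'a::ab_group_add \<Rightarrow> 'a) \<Rightarrow> ('a \<Rightarrow> 'a \<Rightarrow> 'a) \<Rightarrow> 'a tensor_rep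
    \<Rightarrow> (('a \<Rightarrow> 'k) \<Rightarrow> ('a \<Rightarrow> 'k) \<Rightarrow> ('a \<Rightarrow> 'k) \<Rightarrow> 'k)" where
  "N_tensor scale mult r =
     (\<Sum>(a, b)\<leftarrow>r. \<Sum>(a', b')\<leftarrow>r.
        tensor3 scale a a' (mult b b')
      + tensor3 scale a (mult b a' + mult a' b) b'
      + tensor3 scale (mult a a') b' b)"

definition C_tensor ::
  "('k::field \<Rightarrow> 'a::ab_group_add \<Rightarrow> 'a) \<Rightarrow> ('a \<Rightarrow> 'a \<Rightarrow> 'a) \<Rightarrow> 'a tensor_rep
    \<Rightarrow> (('a \<Rightarrow> 'k) \<Rightarrow> ('a \<Rightarrow> 'k) \<Rightarrow> ('a \<Rightarrow> 'k) \<Rightarrow> 'k)" where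
  "C_tensor scale brk r =
     (\<Sum>(a, b)\<leftarrow>r. \<Sum>(a', b')\<leftarrow>r.
        tensor3 scale (brk a a') b b'
      + tensor3 scale a (brk b a') b'
      + tensor3 scale a a' (brk b b'))"

definition GDYBE ::
  "('k::field \<Rightarrow> 'a::ab_group_add \<Rightarrow> 'a) \<Rightarrow> ('a \<Rightarrow> 'a \<Rightarrow> 'a) \<Rightarrow> ('a \<Rightarrow> 'a \<Rightarrow> 'a)
    \<Rightarrow> 'a tensor_rep \<Rightarrow> bool" where
  "GDYBE scale mult brk r \<longleftrightarrow> N_tensor scale mult r = 0 \<and> C_tensor scale brk r = 0"

section \<open>Factorizable Gel'fand-Dorfman bialgebras\<close>

text \<open>\<open>coadj f a\<close> is \<open>f\<^sup>*(a)\<close>.\<close>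

definition coadj :: "('a \<Rightarrow> 'a \<Rightarrow> 'a) \<Rightarrow> 'a \<Rightarrow> ('a \<Rightarrow> 'k::field) \<Rightarrow> ('a \<Rightarrow> 'k)" where
  "coadj f a x = (\<lambda>b. - x (f a b))"

definition dual_mult ::
  "('k::field \<Rightarrow> 'a::ab_group_add \<Rightarrow> 'a) \<Rightarrow> ('a \<Rightarrow> 'a \<Rightarrow> 'a) \<Rightarrow> 'a tensor_rep
    \<Rightarrow> ('a \<Rightarrow> 'k) \<Rightarrow> ('a \<Rightarrow> 'k) \<Rightarrow> ('a \<Rightarrow> 'k)" where
  "dual_mult scale mult r x y =
     coadj mult (r_plus scale r x) y + coadj (\<lambda>a b. mult b a) (r_plus scale r x) y
     - coadj (\<lambda>a b. mult b a) (r_minus scale r y) x"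

definition dual_brk ::
  "('k::field \<Rightarrow> 'a::ab_group_add \<Rightarrow> 'a) \<Rightarrow> ('a \<Rightarrow> 'a \<Rightarrow> 'a) \<Rightarrow> 'a tensor_rep
    \<Rightarrow> ('a \<Rightarrow> 'k) \<Rightarrow> ('a \<Rightarrow> 'k) \<Rightarrow> ('a \<Rightarrow> 'k)" where
  "dual_brk scale brk r x y =
     coadj brk (r_plus scale r x) y - coadj brk (r_minus scale r y) x"

text \<open>
  That a quasi-triangular \<open>(A, \<cdot>, [,], \<alpha>\<^sub>r, \<beta>\<^sub>r)\<close> satisfies the bialgebra axioms is a consequence
  of the conditions on \<open>r\<close>, which are what the notion consists of.
\<close>

definition quasi_triangular ::
  "('k::field \<Rightarrow> 'a::ab_group_add \<Rightarrow> 'a) \<Rightarrow> ('a \<Rightarrow> 'a \<Rightarrow> 'a) \<Rightarrow> ('a \<Rightarrow> 'a \<Rightarrow> 'a)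
    \<Rightarrow> ('a \<Rightarrow> (('a \<Rightarrow> 'k) \<Rightarrow> ('a \<Rightarrow> 'k) \<Rightarrow> 'k)) \<Rightarrow> ('a \<Rightarrow> (('a \<Rightarrow> 'k) \<Rightarrow> ('a \<Rightarrow> 'k) \<Rightarrow> 'k))
    \<Rightarrow> 'a tensor_rep \<Rightarrow> bool" where
  "quasi_triangular scale mult brk \<alpha> \<beta> r \<longleftrightarrow>
     gd_algebra scale UNIV mult brk \<and>
     \<alpha> = alpha_r scale mult r \<and> \<beta> = beta_r scale brk r \<and>
     GDYBE scale mult brk r \<and>
     (\<forall>a. ad_action scale brk a (symmetrized r) = 0) \<and>
     (\<forall>a. LR_action scale mult a (symmetrized r) = 0)"

text \<open>
  Factorizability requires \<open>I\<^sub>G : A\<^sup>* \<rightarrow> A\<close> to be an isomorphism of the vector spaces underlying the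
  two Gel'fand-Dorfman algebras, as for factorizable Lie bialgebras. Literally asking \<open>I\<^sub>G\<close> to
  preserve the products as well would make it false that every quadratic Rota-Baxter
  Gel'fand-Dorfman algebra of nonzero weight yields a factorizable bialgebra, see
  \<open>I_G_not_multiplicative\<close> below: \<open>r\<^sub>+\<close> and \<open>r\<^sub>-\<close> are homomorphisms on \<open>A\<^sup>*\<close>, their difference is not.
\<close>

definition factorizable ::
  "('k::field \<Rightarrow> 'a::ab_group_add \<Rightarrow> 'a) \<Rightarrow> ('a \<Rightarrow> 'a \<Rightarrow> 'a) \<Rightarrow> ('a \<Rightarrow> 'a \<Rightarrow> 'a)
    \<Rightarrow> ('a \<Rightarrow> (('a \<Rightarrow> 'k) \<Rightarrow> ('a \<Rightarrow> 'k) \<Rightarrow> 'k)) \<Rightarrow> ('a \<Rightarrow> (('a \<Rightarrow> 'k) \<Rightarrow> ('a \<Rightarrow> 'k) \<Rightarrow> 'k))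
    \<Rightarrow> 'a tensor_rep \<Rightarrow> bool" where
  "factorizable scale mult brk \<alpha> \<beta> r \<longleftrightarrow>
     quasi_triangular scale mult brk \<alpha> \<beta> r \<and>
     gd_algebra dual_scale (dual scale) (dual_mult scale mult r) (dual_brk scale brk r) \<and>
     linear_iso_on dual_scale (dual scale) scale UNIV (I_G scale r)"

text \<open>
  The isomorphism \<open>I : A\<^sup>* \<rightarrow> A\<close> induced by a nondegenerate form is determined by
  \<open>(a, b) = \<langle>I\<^sup>-\<^sup>1 a, b\<rangle>\<close>, i.e. its inverse is \<open>form\<close> itself, seen as a map into \<open>A\<^sup>*\<close>.
\<close>

definition induced_iso :: "('a \<Rightarrow> 'a \<Rightarrow> 'k) \<Rightarrow> ('a \<Rightarrow> 'k) \<Rightarrow> 'a" where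
  "induced_iso form = inv form"

text \<open>\<open>es\<close> lists the elements of a basis of \<open>A\<close>.\<close>

definition rota_baxter_r ::
  "('k::field \<Rightarrow> 'a::ab_group_add \<Rightarrow> 'a) \<Rightarrow> 'k \<Rightarrow> ('a \<Rightarrow> 'a)
    \<Rightarrow> ('a \<Rightarrow> 'a \<Rightarrow> 'k) \<Rightarrow> 'a list \<Rightarrow> 'a tensor_rep" where
  "rota_baxter_r scale \<theta> B form es =
     map (\<lambda>e. let a = induced_iso form (dual_basis_vector scale (set es) e)
              in (scale (1 / \<theta>) e, B a + scale \<theta> a)) es"


section \<open>The map \<open>I\<^sub>G\<close> is not multiplicative in general\<close>

text \<open>
  Example over the reals: \<open>A\<close> has basis \<open>e = 1\<close>, \<open>f = \<i>\<close> with \<open>e \<cdot> e = e\<close>, \<open>e \<cdot> f = -2 f\<close>,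
  \<open>f \<cdot> e = f\<close>, \<open>f \<cdot> f = 0\<close>, zero bracket, the form with \<open>(e, f) = 1\<close> and \<open>(e, e) = (f, f) = 0\<close>,
  weight \<open>1\<close>, and \<open>B\<close> minus the projection to \<open>e\<close> along \<open>f\<close>.
\<close>

lemma I_G_not_multiplicative:
  "\<exists>(mult :: complex \<Rightarrow> complex \<Rightarrow> complex) brk B (form :: complex \<Rightarrow> complex \<Rightarrow> real) es.
     quadratic_rota_baxter_gd_algebra scaleR UNIV mult brk 1 B form \<and>
     distinct es \<and> \<not> module.dependent scaleR (set es) \<and> module.span scaleR (set es) = UNIV \<and>
     (let r = rota_baxter_r scaleR 1 B form es in
      \<exists>x\<in>dual scaleR. \<exists>y\<in>dual scaleR.
        I_G scaleR r (dual_mult scaleR mult r x y) \<noteq> mult (I_G scaleR r x) (I_G scaleR r y))"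
proof -
  define mult where "mult a b = Complex (Re a * Re b) (Im a * Re b - 2 * Re a * Im b)" for a b
  define brk :: "complex \<Rightarrow> complex \<Rightarrow> complex" where "brk a b = 0" for a b
  define B where "B a = Complex (- Re a) 0" for a
  define form where "form a b = Re a * Im b + Im a * Re b" for a b
  define es where "es = [1, \<i>]"
  note defs = mult_def brk_def B_def form_def
  have quad: "quadratic_rota_baxter_gd_algebra scaleR UNIV mult brk 1 B form"
  proof unfold_locales
    show "a = 0" if "\<forall>b\<in>UNIV. form a b = 0" for a
    proof -
      have "form a 1 = 0" "form a \<i> = 0" using that by auto
      then show ?thesis by (simp add: form_def complex_eq_iff)
    qed
  qed (simp_all add: defs complex_eq_iff algebra_simps
      subspace_UNIV[unfolded subspace_raw_def])
  have span: "span {1, \<i>} = UNIV"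
  proof -
    have "z = Re z *\<^sub>R 1 + Im z *\<^sub>R \<i>" for z by (simp add: complex_eq_iff)
    then have "z \<in> span {1, \<i>}" for z
      by (metis insertI1 insert_subset span_add span_base span_scale subset_insertI)
    then show ?thesis by auto
  qed
  have indep: "independent {1, \<i>}"
    by (auto simp: independent_insert span_singleton complex_eq_iff)
  have rep: "representation {1, \<i>} z = (\<lambda>b. if b = 1 then Re z else if b = \<i> then Im z else 0)" for z
  proof (rule representation_eqI[OF indep])
    show "z \<in> span {1, \<i>}" using span by simp
    have *: "{b. (if b = 1 then Re z else if b = \<i> then Im z else 0) \<noteq> 0} \<subseteq> {1, \<i>}" by auto
    show "finite {b. (if b = 1 then Re z else if b = \<i> then Im z else 0) \<noteq> 0}"
      by (rule finite_subset[OF *]) simp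
    have "(\<Sum>b | (if b = 1 then Re z else if b = \<i> then Im z else 0) \<noteq> 0.
            (if b = 1 then Re z else if b = \<i> then Im z else 0) *\<^sub>R b)
        = (\<Sum>b\<in>{1, \<i>}. (if b = 1 then Re z else if b = \<i> then Im z else 0) *\<^sub>R b)"
      by (rule sum.mono_neutral_left) auto
    also have "\<dots> = z" by (simp add: complex_eq_iff)
    finally show "(\<Sum>b | (if b = 1 then Re z else if b = \<i> then Im z else 0) \<noteq> 0.
            (if b = 1 then Re z else if b = \<i> then Im z else 0) *\<^sub>R b) = z" .
  qed (auto split: if_splits)
  have dual_e: "dual_basis_vector scaleR {1, \<i>} 1 = Re" "dual_basis_vector scaleR {1, \<i>} \<i> = Im"
    unfolding dual_basis_vector_def
    using rep by (auto simp: representation_raw_def[symmetric] fun_eq_iff complex_eq_iff)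
  have inj: "inj form"
  proof (rule injI)
    fix a b assume "form a = form b"
    then have "form a 1 = form b 1" "form a \<i> = form b \<i>" by auto
    then show "a = b" by (simp add: form_def complex_eq_iff)
  qed
  have iso: "induced_iso form Re = \<i>" "induced_iso form Im = 1"
    unfolding induced_iso_def by (rule inv_f_eq[OF inj]; simp add: form_def fun_eq_iff)+
  have r: "rota_baxter_r scaleR 1 B form es = [(1, \<i>), (\<i>, 0)]"
    by (simp add: rota_baxter_r_def es_def dual_e iso B_def complex_eq_iff)
  have "(*) = (scaleR :: real \<Rightarrow> real \<Rightarrow> real)" by (simp add: fun_eq_iff)
  then have Im: "Im \<in> dual scaleR"
    using bounded_linear.linear[OF bounded_linear_Im] by (simp add: dual_def linear_def)
  have "I_G scaleR [(1, \<i>), (\<i>, 0)] (dual_mult scaleR mult [(1, \<i>), (\<i>, 0)] Im Im)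
      \<noteq> mult (I_G scaleR [(1, \<i>), (\<i>, 0)] Im) (I_G scaleR [(1, \<i>), (\<i>, 0)] Im)"
    by (simp add: I_G_def dual_mult_def r_plus_def r_minus_def coadj_def mult_def complex_eq_iff)
  then show ?thesis
    using quad span[unfolded span_raw_def] indep[unfolded dependent_raw_def] Im r
    by (intro exI[of _ mult] exI[of _ brk] exI[of _ B] exI[of _ form] exI[of _ es])
       (auto simp: es_def Let_def complex_eq_iff)
qed

end

theory Submission
  imports Defs
begin

text \<open>
  Write \<open>p = r\<^sub>+ \<circ> I\<^sub>G\<^sup>-\<^sup>1\<close> and \<open>m = r\<^sub>- \<circ> I\<^sub>G\<^sup>-\<^sup>1\<close>, two endomorphisms of \<open>A\<close> with \<open>p = m + id\<close>. Everything is
  read off from the bilinear form \<open>(a, b) = \<langle>I\<^sub>G\<^sup>-\<^sup>1 a, b\<rangle>\<close>, under which the data of a factorizable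
  bialgebra translate as follows.

  \<^item> The symmetric part of \<open>r\<close> is the tensor inverse to the form, so the form is symmetric, and
    invariance of the symmetric part says exactly that the form is invariant
    (\<open>invariant_iff_quadratic\<close>).
  \<^item> Since \<open>r\<^sub>+\<close> and \<open>- r\<^sub>-\<close> are transposes of each other, \<open>p\<close> and \<open>- m\<close> are adjoint for the form, that is,
    \<open>(m a, b) + (a, m b) + (a, b) = 0\<close>.
  \<^item> Evaluate \<open>N(r)\<close> and \<open>C(r)\<close> at the functionals \<open>(a, -)\<close>, \<open>(b, -)\<close>, \<open>(c, -)\<close>. Invariance of the form and
    adjointness bring all terms to the shape \<open>(c, -)\<close>, and what stands there is
    \<open>m a * m b - m (m a * b + a * m b + a * b)\<close>, for both products \<open>*\<close>
    (\<open>N_tensor_form\<close>, \<open>C_tensor_form\<close>). As the form is nondegenerate, \<open>r\<close> solves the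
    Yang-Baxter equation if and only if \<open>m\<close> is a Rota-Baxter operator of weight \<open>1\<close>.

  The first half of the theorem follows since \<open>\<theta> m\<close> is then a Rota-Baxter operator of weight \<open>\<theta>\<close>. For the
  second half, the tensor built from \<open>B\<close> has \<open>I\<^sub>G\<^sup>-\<^sup>1 a = (a, -)\<close> and \<open>m = \<theta>\<^sup>-\<^sup>1 B\<close>
  (\<open>rota_baxter_r_contractions\<close>), so the same equivalences apply backwards. It remains to see
  that \<open>A\<^sup>*\<close> is a Gel'fand-Dorfman algebra. The products of \<open>A\<^sup>*\<close> correspond to the products
  \<open>m a * b + a * m b + a * b\<close> on \<open>A\<close>, so the Rota-Baxter identity makes \<open>r\<^sub>-\<close> and \<open>r\<^sub>+\<close> multiplicative;
  because \<open>r\<^sub>+ - r\<^sub>-\<close> is injective, \<open>A\<^sup>*\<close> embeds into \<open>A \<oplus> A\<close> and inherits all identities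
  (\<open>gd_algebra_pullback\<close>).
\<close>

section \<open>Evaluating tensors on linear functionals\<close>

lemma sum_list_fun_apply: "sum_list fs x = (\<Sum>f\<leftarrow>fs. f x)"
  by (induction fs) auto

context vector_space
begin

lemma dual_iff:
  "x \<in> dual scale \<longleftrightarrow>
     (\<forall>a b. x (a + b) = x a + x b) \<and> (\<forall>c a. x (scale c a) = c * x a)"
proof -
  have "vector_space ((*) :: 'a \<Rightarrow> 'a \<Rightarrow> 'a)" by unfold_locales (auto simp: algebra_simps)
  then show ?thesis
    by (auto simp: dual_def Vector_Spaces.linear_def module_hom_def module_hom_axioms_def
        module_iff_vector_space vector_space_axioms)
qed

lemma dual_add: "x \<in> dual scale \<Longrightarrow> x (a + b) = x a + x b"
  and dual_homogeneous: "x \<in> dual scale \<Longrightarrow> x (scale c a) = c * x a"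
  by (simp_all add: dual_iff)

lemma dual_uminus: "x \<in> dual scale \<Longrightarrow> x (- a) = - x a"
  using dual_homogeneous[of x "-1" a] by simp

lemma dual_diff: "x \<in> dual scale \<Longrightarrow> x (a - b) = x a - x b"
  using dual_add[of x a "- b"] by (simp add: dual_uminus)

lemma dual_zero: "x \<in> dual scale \<Longrightarrow> x 0 = 0"
  using dual_homogeneous[of x 0 0] by simp

lemma dual_sum_list:
  "x \<in> dual scale \<Longrightarrow> x (\<Sum>s\<leftarrow>ss. scale (f s) (g s)) = (\<Sum>s\<leftarrow>ss. f s * x (g s))"
  by (induction ss) (simp_all add: dual_add dual_homogeneous dual_zero)

text \<open>This turns the double sums in \<open>N(r)\<close> and \<open>C(r)\<close> into single products of contractions of \<open>r\<close>.\<close>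

lemma bilinear_sum_list:
  assumes "\<And>v. (\<lambda>u. D u v) \<in> dual scale" and "\<And>u. D u \<in> dual scale"
  shows "D (\<Sum>s\<leftarrow>ss. scale (f s) (g s)) (\<Sum>t\<leftarrow>ts. scale (h t) (k t))
     = (\<Sum>s\<leftarrow>ss. \<Sum>t\<leftarrow>ts. f s * h t * D (g s) (k t))"
  unfolding dual_sum_list[OF assms(1)]
  by (simp add: dual_sum_list[OF assms(2)] sum_list_const_mult mult.assoc)

lemma r_plus_eq: "r_plus scale r x = (\<Sum>s\<leftarrow>r. scale (x (fst s)) (snd s))"
  and r_minus_eq: "- r_minus scale r x = (\<Sum>s\<leftarrow>r. scale (x (snd s)) (fst s))"
  by (simp_all add: r_plus_def r_minus_def case_prod_unfold)

text \<open>The two contractions of a tensor are adjoint to each other up to sign: both sides are the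
  value of the tensor at \<open>(x, y)\<close>.\<close>

lemma r_plus_r_minus_adjoint:
  assumes "x \<in> dual scale" "y \<in> dual scale"
  shows "y (r_plus scale r x) = - x (r_minus scale r y)"
proof -
  have "y (r_plus scale r x) = x (- r_minus scale r y)"
    by (simp add: r_plus_eq r_minus_eq dual_sum_list[OF assms(1)] dual_sum_list[OF assms(2)]
        mult.commute)
  then show ?thesis using assms by (simp add: dual_uminus)
qed

lemma r_plus_add: "r_plus scale r (x + y) = r_plus scale r x + r_plus scale r y"
  by (simp add: r_plus_eq scale_left_distrib sum_list_addf)

lemma r_plus_scale: "r_plus scale r (dual_scale c x) = scale c (r_plus scale r x)"
  by (induction r) (auto simp: r_plus_eq dual_scale_def scale_right_distrib)

lemma r_minus_add: "r_minus scale r (x + y) = r_minus scale r x + r_minus scale r y"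
proof -
  have "- r_minus scale r (x + y) = - r_minus scale r x + - r_minus scale r y"
    unfolding r_minus_eq by (simp add: scale_left_distrib sum_list_addf)
  then show ?thesis by (simp add: algebra_simps)
qed

lemma r_minus_scale: "r_minus scale r (dual_scale c x) = scale c (r_minus scale r x)"
proof -
  have "- r_minus scale r (dual_scale c x) = scale c (- r_minus scale r x)"
    unfolding r_minus_eq by (induction r) (auto simp: dual_scale_def scale_right_distrib)
  then show ?thesis by simp
qed

end

context bilinear_product
begin

lemma functional_of_product:
  assumes "V = UNIV" "x \<in> dual scale"
  shows "(\<lambda>u. x (mult u v)) \<in> dual scale" and "(\<lambda>v. x (mult u v)) \<in> dual scale"
  using assms by (simp_all add: dual_iff mult_add_left mult_add_right mult_scale_left mult_scale_right)

lemma product_of_sums: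
  assumes "V = UNIV" "x \<in> dual scale"
  shows "x (mult (\<Sum>s\<leftarrow>ss. scale (f s) (g s)) (\<Sum>t\<leftarrow>ts. scale (h t) (k t)))
     = (\<Sum>s\<leftarrow>ss. \<Sum>t\<leftarrow>ts. f s * h t * x (mult (g s) (k t)))"
    and "x (mult (\<Sum>t\<leftarrow>ts. scale (h t) (k t)) (\<Sum>s\<leftarrow>ss. scale (f s) (g s)))
     = (\<Sum>s\<leftarrow>ss. \<Sum>t\<leftarrow>ts. f s * h t * x (mult (k t) (g s)))"
  using bilinear_sum_list[where D = "\<lambda>u v. x (mult u v)" and ss = ss and f = f and g = g
      and ts = ts and h = h and k = k]
    bilinear_sum_list[where D = "\<lambda>u v. x (mult v u)" and ss = ss and f = f and g = g
      and ts = ts and h = h and k = k]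
    functional_of_product[OF assms]
  by auto

lemma N_tensor_apply:
  assumes V: "V = UNIV" and xyz: "x \<in> dual scale" "y \<in> dual scale" "z \<in> dual scale"
  shows "N_tensor scale mult r x y z =
     z (mult (r_plus scale r x) (r_plus scale r y))
     + y (mult (r_plus scale r x) (- r_minus scale r z)
        + mult (- r_minus scale r z) (r_plus scale r x))
     + x (mult (- r_minus scale r z) (- r_minus scale r y))"
  unfolding r_plus_eq r_minus_eq dual_add[OF xyz(2)]
    product_of_sums(1)[OF V xyz(3)] product_of_sums(1)[OF V xyz(1)] product_of_sums(1)[OF V xyz(2), where f = "\<lambda>s. x (fst s)" and g = snd]
    product_of_sums(2)[OF V xyz(2), where f = "\<lambda>s. x (fst s)" and g = snd]
  using xyz
  by (simp add: N_tensor_def tensor3_def sum_list_fun_apply case_prod_unfold comp_def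
      sum_list_addf[symmetric] dual_add[OF xyz(2)] algebra_simps)

lemma C_tensor_apply:
  assumes V: "V = UNIV" and xyz: "x \<in> dual scale" "y \<in> dual scale" "z \<in> dual scale"
  shows "C_tensor scale mult r x y z =
     x (mult (- r_minus scale r y) (- r_minus scale r z))
     + y (mult (r_plus scale r x) (- r_minus scale r z))
     + z (mult (r_plus scale r x) (r_plus scale r y))"
  unfolding r_plus_eq r_minus_eq
    product_of_sums(1)[OF V xyz(3)] product_of_sums(1)[OF V xyz(1)] product_of_sums(1)[OF V xyz(2)]
  using xyz
  by (simp add: C_tensor_def tensor3_def sum_list_fun_apply case_prod_unfold comp_def
      sum_list_addf[symmetric] algebra_simps)

lemma I_G_functional:
  assumes "f \<in> dual scale"
  shows "f (I_G scale r x) = (\<Sum>s\<leftarrow>r. x (fst s) * f (snd s) + x (snd s) * f (fst s))"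
proof -
  have "I_G scale r x = (\<Sum>s\<leftarrow>r. scale (x (fst s)) (snd s)) + (\<Sum>s\<leftarrow>r. scale (x (snd s)) (fst s))"
    unfolding I_G_def r_plus_eq[symmetric] r_minus_eq[symmetric] by simp
  then show ?thesis by (simp add: dual_add[OF assms] dual_sum_list[OF assms] sum_list_addf)
qed

lemma LR_action_symmetrized_apply:
  assumes V: "V = UNIV" and xy: "x \<in> dual scale" "y \<in> dual scale"
  shows "LR_action scale mult a (symmetrized r) x y =
     x (mult a (I_G scale r y)) + y (mult a (I_G scale r x) + mult (I_G scale r x) a)"
  using xy functional_of_product[OF V]
  by (simp add: LR_action_def tensor2_def sum_list_fun_apply case_prod_unfold comp_def
      I_G_functional[of "\<lambda>u. x (mult a u)"] I_G_functional[of "\<lambda>u. y (mult a u)"]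
      I_G_functional[of "\<lambda>u. y (mult u a)"] sum_list_addf[symmetric] dual_add[OF xy(2)] algebra_simps)

lemma ad_action_symmetrized_apply:
  assumes V: "V = UNIV" and xy: "x \<in> dual scale" "y \<in> dual scale"
  shows "ad_action scale mult a (symmetrized r) x y =
     x (mult a (I_G scale r y)) + y (mult a (I_G scale r x))"
  using xy functional_of_product[OF V]
  by (simp add: ad_action_def tensor2_def sum_list_fun_apply case_prod_unfold comp_def
      I_G_functional[of "\<lambda>u. x (mult a u)"] I_G_functional[of "\<lambda>u. y (mult a u)"]
      sum_list_addf[symmetric] algebra_simps)

end

text \<open>
  Tensors are extended by zero to arguments outside of the dual, so that their vanishing has to be
  tested on functionals only.
\<close>

lemma N_tensor_eq_0_iff:
  "N_tensor scale mult r = 0 \<longleftrightarrow>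
    (\<forall>x\<in>dual scale. \<forall>y\<in>dual scale. \<forall>z\<in>dual scale. N_tensor scale mult r x y z = 0)"
proof -
  have "N_tensor scale mult r x y z = 0"
    if "x \<notin> dual scale \<or> y \<notin> dual scale \<or> z \<notin> dual scale" for x y z
    using that by (elim disjE) (simp_all add: N_tensor_def sum_list_fun_apply tensor3_def case_prod_unfold comp_def)
  then show ?thesis by (fastforce simp: fun_eq_iff)
qed

lemma C_tensor_eq_0_iff:
  "C_tensor scale mult r = 0 \<longleftrightarrow>
    (\<forall>x\<in>dual scale. \<forall>y\<in>dual scale. \<forall>z\<in>dual scale. C_tensor scale mult r x y z = 0)"
proof -
  have "C_tensor scale mult r x y z = 0"
    if "x \<notin> dual scale \<or> y \<notin> dual scale \<or> z \<notin> dual scale" for x y z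
    using that by (elim disjE) (simp_all add: C_tensor_def sum_list_fun_apply tensor3_def case_prod_unfold comp_def)
  then show ?thesis by (fastforce simp: fun_eq_iff)
qed

lemma LR_action_eq_0_iff:
  "LR_action scale mult a r = 0 \<longleftrightarrow>
    (\<forall>x\<in>dual scale. \<forall>y\<in>dual scale. LR_action scale mult a r x y = 0)"
proof -
  have "LR_action scale mult a r x y = 0" if "x \<notin> dual scale \<or> y \<notin> dual scale" for x y
    using that by (elim disjE) (simp_all add: LR_action_def sum_list_fun_apply tensor2_def case_prod_unfold comp_def)
  then show ?thesis by (fastforce simp: fun_eq_iff)
qed

lemma ad_action_eq_0_iff:
  "ad_action scale mult a r = 0 \<longleftrightarrow>
    (\<forall>x\<in>dual scale. \<forall>y\<in>dual scale. ad_action scale mult a r x y = 0)"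
proof -
  have "ad_action scale mult a r x y = 0" if "x \<notin> dual scale \<or> y \<notin> dual scale" for x y
    using that by (elim disjE) (simp_all add: ad_action_def sum_list_fun_apply tensor2_def case_prod_unfold comp_def)
  then show ?thesis by (fastforce simp: fun_eq_iff)
qed

lemma (in lie_algebra) skew:
  assumes "a \<in> V" "b \<in> V" shows "brk a b = - brk b a"
proof -
  have "a + b \<in> V" using assms carrier_subspace by (simp add: subspace_add)
  then have "brk a (a + b) + brk b (a + b) = 0"
    using alternating[of "a + b"] assms by (simp add: mult_add_left)
  then show ?thesis
    using assms by (simp add: mult_add_right alternating eq_neg_iff_add_eq_0)
qed

section \<open>Novikov and Lie products pulled back along an embedding\<close>

locale joint_embedding = A: vector_space scale + W: vector_space scaleW
  for scale :: "'k::field \<Rightarrow> 'v::ab_group_add \<Rightarrow> 'v"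
    and scaleW :: "'k \<Rightarrow> 'w::ab_group_add \<Rightarrow> 'w" +
  fixes W :: "'w set" and f g :: "'w \<Rightarrow> 'v"
  assumes subspace_W: "W.subspace W"
    and f_add: "\<lbrakk>x \<in> W; y \<in> W\<rbrakk> \<Longrightarrow> f (x + y) = f x + f y"
    and g_add: "\<lbrakk>x \<in> W; y \<in> W\<rbrakk> \<Longrightarrow> g (x + y) = g x + g y"
    and f_scale: "x \<in> W \<Longrightarrow> f (scaleW c x) = scale c (f x)"
    and g_scale: "x \<in> W \<Longrightarrow> g (scaleW c x) = scale c (g x)"
    and separating: "\<lbrakk>x \<in> W; y \<in> W; f x = f y; g x = g y\<rbrakk> \<Longrightarrow> x = y"
begin

lemma W_closed:
  "0 \<in> W" "\<lbrakk>x \<in> W; y \<in> W\<rbrakk> \<Longrightarrow> x + y \<in> W" "x \<in> W \<Longrightarrow> scaleW c x \<in> W"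
  "\<lbrakk>x \<in> W; y \<in> W\<rbrakk> \<Longrightarrow> x - y \<in> W"
  using subspace_W by (auto simp: W.subspace_def intro: W.subspace_diff)

lemma f_zero: "f 0 = 0" and g_zero: "g 0 = 0"
  using f_add[of 0 0] g_add[of 0 0] by (simp_all add: W_closed)

lemma f_diff: "\<lbrakk>x \<in> W; y \<in> W\<rbrakk> \<Longrightarrow> f (x - y) = f x - f y"
  and g_diff: "\<lbrakk>x \<in> W; y \<in> W\<rbrakk> \<Longrightarrow> g (x - y) = g x - g y"
  using f_add[of "x - y" y] g_add[of "x - y" y] by (simp_all add: W_closed)

text \<open>
  The pair \<open>(f, g)\<close> embeds \<open>W\<close> into the direct sum of two copies of the algebra. Hence every identity,
  bilinearity included, may be checked after applying \<open>f\<close> and after applying \<open>g\<close>; only closedness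
  has to be known beforehand.
\<close>

lemma gd_algebra_pullback:
  assumes gd: "gd_algebra scale UNIV mult brk"
    and mult_W: "\<And>x y. \<lbrakk>x \<in> W; y \<in> W\<rbrakk> \<Longrightarrow> multW x y \<in> W"
    and brk_W: "\<And>x y. \<lbrakk>x \<in> W; y \<in> W\<rbrakk> \<Longrightarrow> brkW x y \<in> W"
    and hom: "\<And>x y. \<lbrakk>x \<in> W; y \<in> W\<rbrakk> \<Longrightarrow> f (multW x y) = mult (f x) (f y)"
      "\<And>x y. \<lbrakk>x \<in> W; y \<in> W\<rbrakk> \<Longrightarrow> g (multW x y) = mult (g x) (g y)"
      "\<And>x y. \<lbrakk>x \<in> W; y \<in> W\<rbrakk> \<Longrightarrow> f (brkW x y) = brk (f x) (f y)"
      "\<And>x y. \<lbrakk>x \<in> W; y \<in> W\<rbrakk> \<Longrightarrow> g (brkW x y) = brk (g x) (g y)"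
  shows "gd_algebra scaleW W multW brkW"
proof -
  interpret gd_algebra scale UNIV mult brk by (fact gd)
  note rules = W_closed mult_W brk_W hom f_zero g_zero f_add g_add f_diff g_diff f_scale g_scale
  show ?thesis
  proof unfold_locales
    show "W.subspace W" by (fact subspace_W)
  next
    fix a b c assume abc: "a \<in> W" "b \<in> W" "c \<in> W"
    show "multW (multW a b) c - multW a (multW b c) = multW (multW b a) c - multW b (multW a c)"
      by (rule separating) (simp_all add: rules abc nov.left_symmetric[of "f a"] nov.left_symmetric[of "g a"])
    show "multW (multW a b) c = multW (multW a c) b"
      by (rule separating)
        (simp_all add: rules abc nov.right_commutative[of _ "f b"] nov.right_commutative[of _ "g b"])
    show "brkW a (brkW b c) + brkW b (brkW c a) + brkW c (brkW a b) = 0"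
      by (rule separating) (simp_all add: rules abc lie.jacobi)
    show "brkW (multW a b) c - brkW (multW a c) b + multW (brkW a b) c - multW (brkW a c) b
        - multW a (brkW b c) = 0"
      by (rule separating) (simp_all add: rules abc gd_compatible del: right_minus_eq)
  qed (rule separating; simp add: rules nov.mult_add_left nov.mult_add_right nov.mult_scale_left
      nov.mult_scale_right lie.mult_add_left lie.mult_add_right lie.mult_scale_left
      lie.mult_scale_right lie.alternating; fail | simp add: rules)+
qed

end

section \<open>A tensor whose symmetric part is a form\<close>

text \<open>
  The common setting of both directions: \<open>I\<^sub>G : A\<^sup>* \<rightarrow> A\<close> is invertible, and \<open>form\<close> is its inverse, viewed
  as a bilinear form. Bilinearity and symmetry are consequences.
\<close>

locale tensor_with_form = gd_algebra scale UNIV mult brk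
  for scale :: "'k::field \<Rightarrow> 'a::ab_group_add \<Rightarrow> 'a" and mult brk +
  fixes r :: "'a tensor_rep" and form :: "'a \<Rightarrow> 'a \<Rightarrow> 'k"
  assumes range_form: "range form = dual scale"
    and I_G_form: "I_G scale r (form a) = a"
begin

text \<open>This is \<open>r\<^sub>- \<circ> I\<^sub>G\<^sup>-\<^sup>1\<close>, the map \<open>m\<close> of the introduction.\<close>

definition minus_part :: "'a \<Rightarrow> 'a" where "minus_part a = r_minus scale r (form a)"

lemma form_dual: "form a \<in> dual scale" using range_form by blast

lemma dualE: assumes "x \<in> dual scale" obtains a where "x = form a"
  using assms range_form by blast

lemma r_plus_form: "r_plus scale r (form a) = minus_part a + a"
  using I_G_form[of a] by (simp add: I_G_def minus_part_def algebra_simps)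

text \<open>Linearity in the first argument holds because \<open>I\<^sub>G\<close>, whose inverse \<open>form\<close> is, is linear.\<close>

lemma form_left_add: "form (a + b) = form a + form b"
proof -
  have "form a + form b \<in> dual scale"
    using form_dual[of a] form_dual[of b] by (auto simp: nov.dual_iff algebra_simps)
  then obtain c where c: "form a + form b = form c" by (rule dualE)
  have "I_G scale r (form a + form b) = a + b"
    using I_G_form[of a] I_G_form[of b]
    by (simp add: I_G_def nov.r_plus_add nov.r_minus_add algebra_simps)
  then show ?thesis using c I_G_form by metis
qed

lemma form_left_scale: "form (scale t a) = dual_scale t (form a)"
proof -
  have "dual_scale t (form a) \<in> dual scale"
    using form_dual[of a] by (auto simp: nov.dual_iff dual_scale_def algebra_simps)
  then obtain c where c: "dual_scale t (form a) = form c" by (rule dualE)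
  have "I_G scale r (dual_scale t (form a)) = scale t a"
    using I_G_form[of a]
    by (simp add: I_G_def nov.r_plus_scale nov.r_minus_scale nov.scale_right_diff_distrib[symmetric])
  then show ?thesis using c I_G_form by metis
qed

text \<open>
  The adjointness of \<open>r\<^sub>+\<close> and \<open>- r\<^sub>-\<close>, with \<open>r\<^sub>+\<close> eliminated. The first two summands are symmetric under
  exchanging \<open>a\<close> and \<open>b\<close>, hence so is the form.
\<close>

lemma form_minus_part: "form b (minus_part a) + form a (minus_part b) + form b a = 0"
  using nov.r_plus_r_minus_adjoint[of "form a" "form b" r]
  by (simp add: form_dual r_plus_form nov.dual_add[OF form_dual] minus_part_def[symmetric]) algebra

lemma form_commute: "form a b = form b a"
  using form_minus_part[of a b] form_minus_part[of b a] by algebra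

lemma form_inject: "form a = form b \<longleftrightarrow> a = b"
  using I_G_form by metis

lemma minus_part_add: "minus_part (a + b) = minus_part a + minus_part b"
  and minus_part_scale: "minus_part (scale t a) = scale t (minus_part a)"
  by (simp_all add: minus_part_def form_left_add form_left_scale nov.r_minus_add nov.r_minus_scale)

lemmas form_right_simps = nov.dual_add[OF form_dual] nov.dual_diff[OF form_dual]
  nov.dual_uminus[OF form_dual] nov.dual_homogeneous[OF form_dual] nov.dual_zero[OF form_dual]

lemma form_left_simps:
  "form (a + b) c = form a c + form b c" "form (- a) c = - form a c"
  "form (a - b) c = form a c - form b c" "form (scale t a) c = t * form a c" "form 0 c = 0"
  using form_right_simps[of c] by (simp_all add: form_commute[of _ c])

lemma form_minus_part_right: "form a (minus_part b) = - form (minus_part a) b - form a b"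
  using form_minus_part[of b a] form_commute[of "minus_part a" b] form_commute[of a b] by algebra

end

text \<open>
  At the functionals \<open>(c, -)\<close> and \<open>(b, -)\<close> the action of \<open>a\<close> on the symmetric part takes the values
  \<open>(c, [a, b]) + (b, [a, c])\<close> and \<open>(c, a \<cdot> b) + (b, a \<cdot> c + c \<cdot> a)\<close>. Up to symmetry of the form and skew
  symmetry of the bracket, their vanishing is the invariance of the form.
\<close>

lemma (in tensor_with_form) invariant_iff_quadratic:
  "(\<forall>a. ad_action scale brk a (symmetrized r) = 0) \<and>
   (\<forall>a. LR_action scale mult a (symmetrized r) = 0)
   \<longleftrightarrow> quadratic_gd_algebra scale UNIV mult brk form"
proof
  assume inv: "(\<forall>a. ad_action scale brk a (symmetrized r) = 0) \<and>
   (\<forall>a. LR_action scale mult a (symmetrized r) = 0)"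
  have ad: "form c (brk a b) + form b (brk a c) = 0" for a b c
    using inv lie.ad_action_symmetrized_apply[OF refl form_dual form_dual, of a r c b]
    by (simp add: I_G_form)
  have LR: "form c (mult a b) + form b (mult a c + mult c a) = 0" for a b c
    using inv nov.LR_action_symmetrized_apply[OF refl form_dual form_dual, of a r c b]
    by (simp add: I_G_form)
  show "quadratic_gd_algebra scale UNIV mult brk form"
  proof unfold_locales
    show "a = 0" if "\<forall>b\<in>UNIV. form a b = 0" for a
      using that form_inject[of a 0] by (simp add: fun_eq_iff form_left_simps)
    show "form (brk a b) c = form a (brk b c)" for a b c
    proof -
      have "form (brk a b) c = form c (- brk b a)"
        using lie.skew[of a b] by (simp add: form_commute[of _ c])
      then show ?thesis using ad[of c b a] by (simp add: form_right_simps neg_eq_iff_add_eq_0)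
    qed
    show "form (mult a b) c = - form b (mult a c + mult c a)" for a b c
      using LR[of c a b] by (simp add: form_commute[of _ c] eq_neg_iff_add_eq_0)
  qed (rule form_commute | simp add: form_left_simps)+
next
  assume "quadratic_gd_algebra scale UNIV mult brk form"
  then interpret quadratic_gd_algebra scale UNIV mult brk form .
  have "form c (brk a b) + form b (brk a c) = 0" for a b c
    using form_brk[of b a c] lie.skew[of b a] form_commute[of c "brk a b"]
    by (simp add: form_left_simps neg_eq_iff_add_eq_0)
  moreover have "form c (mult a b) + form b (mult a c + mult c a) = 0" for a b c
    using form_mult[of a b c] form_commute[of c "mult a b"] by simp
  ultimately show "(\<forall>a. ad_action scale brk a (symmetrized r) = 0) \<and>
   (\<forall>a. LR_action scale mult a (symmetrized r) = 0)"
    using lie.ad_action_symmetrized_apply nov.LR_action_symmetrized_apply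
    by (auto simp: LR_action_eq_0_iff ad_action_eq_0_iff I_G_form form_dual elim!: dualE)
qed

locale invariant_tensor = tensor_with_form scale mult brk r form +
    quadratic_gd_algebra scale UNIV mult brk form
  for scale :: "'k::field \<Rightarrow> 'a::ab_group_add \<Rightarrow> 'a" and mult brk r form
begin

text \<open>
  Exchanging \<open>a\<close> and \<open>c\<close> does not change the left-hand side of the first rule, whence the second one.
\<close>

lemma form_mult_adjoint:
  "form b (mult a c + mult c a) = - form (mult a b) c"
  "form a (mult c b) = form (mult a b) c"
proof -
  show *: "form b (mult a c + mult c a) = - form (mult a b) c" for a b c
    using form_mult[of a b c] by simp
  show "form a (mult c b) = form (mult a b) c"
    using *[of b a c] *[of b c a] form_commute[of a "mult c b"] by (simp add: add.commute)
qed

lemma form_brk_adjoint: "form b (brk a c) = - form (brk a b) c"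
  using form_brk[of b a c] lie.skew[of b a] by (simp add: form_left_simps)

text \<open>
  Two of the three terms of the Yang-Baxter expression carry \<open>m c\<close> inside a product. Invariance of the
  form moves it out into the second argument, where \<open>(u, m c) = - (m u, c) - (u, c)\<close>. The remainders
  \<open>- (u, c)\<close> cancel all of the expansion of \<open>(m a + a) \<cdot> (m b + b)\<close> except for \<open>m a \<cdot> m b\<close>. The same happens
  for the bracket.
\<close>

lemma N_tensor_form:
  "N_tensor scale mult r (form a) (form b) (form c) =
     form c (mult (minus_part a) (minus_part b)
       - minus_part (mult (minus_part a) b + mult a (minus_part b) + mult a b))"
proof -
  let ?m = minus_part
  have mm: "mult (- u) (- v) = mult u v" for u v
    using nov.mult_scale_left[of u "- v" "-1"] nov.mult_scale_right[of u v "-1"] by simp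
  have "N_tensor scale mult r (form a) (form b) (form c) =
      form c (mult (?m a + a) (?m b + b))
      + form b (mult (?m a + a) (- ?m c) + mult (- ?m c) (?m a + a))
      + form a (mult (?m c) (?m b))"
    by (simp add: nov.N_tensor_apply form_dual r_plus_form minus_part_def[symmetric] mm)
  also have "\<dots> = form (mult (?m a + a) (?m b + b)) c
      + form (mult (?m a + a) b) (?m c) + form (mult a (?m b)) (?m c)"
  proof -
    have "form b (mult (?m a + a) (- ?m c) + mult (- ?m c) (?m a + a))
        = form (mult (?m a + a) b) (?m c)"
      using form_mult_adjoint(1)[of b "?m a + a" "- ?m c"] by (simp add: form_right_simps)
    moreover have "form a (mult (?m c) (?m b)) = form (mult a (?m b)) (?m c)"
      by (rule form_mult_adjoint(2))
    ultimately show ?thesis by (simp add: form_commute[of c])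
  qed
  also have "\<dots> = form c (mult (?m a) (?m b) - ?m (mult (?m a) b + mult a (?m b) + mult a b))"
    by (simp add: form_minus_part_right form_commute[of c] form_left_simps minus_part_add
        nov.mult_add_left nov.mult_add_right)
  finally show ?thesis .
qed

lemma C_tensor_form:
  "C_tensor scale brk r (form a) (form b) (form c) =
     form c (brk (minus_part a) (minus_part b)
       - minus_part (brk (minus_part a) b + brk a (minus_part b) + brk a b))"
proof -
  let ?m = minus_part
  have mm: "brk (- u) (- v) = brk u v" for u v
    using lie.mult_scale_left[of u "- v" "-1"] lie.mult_scale_right[of u v "-1"] by simp
  have "C_tensor scale brk r (form a) (form b) (form c) =
      form a (brk (?m b) (?m c)) + form b (brk (?m a + a) (- ?m c))
      + form c (brk (?m a + a) (?m b + b))"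
    by (simp add: lie.C_tensor_apply form_dual r_plus_form minus_part_def[symmetric] mm)
  also have "\<dots> = form (brk a (?m b)) (?m c) + form (brk (?m a + a) b) (?m c)
      + form (brk (?m a + a) (?m b + b)) c"
  proof -
    have "form a (brk (?m b) (?m c)) = form (brk a (?m b)) (?m c)"
      using form_brk by simp
    moreover have "form b (brk (?m a + a) (- ?m c)) = form (brk (?m a + a) b) (?m c)"
      using form_brk_adjoint[of b "?m a + a" "- ?m c"] by (simp add: form_right_simps)
    ultimately show ?thesis by (simp add: form_commute[of c])
  qed
  also have "\<dots> = form c (brk (?m a) (?m b) - ?m (brk (?m a) b + brk a (?m b) + brk a b))"
    by (simp add: form_minus_part_right form_commute[of c] form_left_simps minus_part_add
        lie.mult_add_left lie.mult_add_right)
  finally show ?thesis .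
qed

lemma form_eq_0_iff: "(\<forall>c. form c a = 0) \<longleftrightarrow> a = 0"
  using form_nondegenerate[of a] by (auto simp: form_commute[of a] form_right_simps)

lemma GDYBE_iff_rota_baxter:
  "GDYBE scale mult brk r \<longleftrightarrow> rota_baxter_gd_algebra scale UNIV mult brk 1 minus_part"
proof -
  have quantify: "(\<forall>x\<in>dual scale. P x) \<longleftrightarrow> (\<forall>a. P (form a))" for P
    by (metis form_dual dualE)
  have "GDYBE scale mult brk r \<longleftrightarrow>
    (\<forall>a b. mult (minus_part a) (minus_part b)
       = minus_part (mult (minus_part a) b + mult a (minus_part b) + mult a b)) \<and>
    (\<forall>a b. brk (minus_part a) (minus_part b)
       = minus_part (brk (minus_part a) b + brk a (minus_part b) + brk a b))"
    by (simp add: GDYBE_def N_tensor_eq_0_iff C_tensor_eq_0_iff quantify N_tensor_form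
        C_tensor_form form_eq_0_iff)
  also have "\<dots> \<longleftrightarrow> rota_baxter_gd_algebra scale UNIV mult brk 1 minus_part"
    using gd_algebra_axioms
    by (auto simp: rota_baxter_gd_algebra_def rota_baxter_gd_algebra_axioms_def minus_part_add
        minus_part_scale)
  finally show ?thesis .
qed

text \<open>
  Along \<open>I\<^sub>G\<close>, the products on the dual are those which turn the Rota-Baxter operator \<open>minus_part\<close> into a
  homomorphism.
\<close>

lemma dual_mult_form:
  "dual_mult scale mult r (form a) (form b) =
     form (mult (minus_part a) b + mult a (minus_part b) + mult a b)"
proof
  fix d
  have "dual_mult scale mult r (form a) (form b) d =
      - form b (mult (minus_part a + a) d + mult d (minus_part a + a))
      + form a (mult d (minus_part b))"
    by (simp add: dual_mult_def coadj_def r_plus_form minus_part_def[symmetric] form_right_simps)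
  then show "dual_mult scale mult r (form a) (form b) d =
      form (mult (minus_part a) b + mult a (minus_part b) + mult a b) d"
    using form_mult_adjoint(1)[of b "minus_part a + a" d] form_mult_adjoint(2)[of a d "minus_part b"]
    by (simp add: form_left_simps nov.mult_add_left)
qed

lemma dual_brk_form:
  "dual_brk scale brk r (form a) (form b) =
     form (brk (minus_part a) b + brk a (minus_part b) + brk a b)"
proof
  fix d
  have "dual_brk scale brk r (form a) (form b) d =
      - form b (brk (minus_part a + a) d) + form a (brk (minus_part b) d)"
    by (simp add: dual_brk_def coadj_def r_plus_form minus_part_def[symmetric])
  then show "dual_brk scale brk r (form a) (form b) d =
      form (brk (minus_part a) b + brk a (minus_part b) + brk a b) d"
    using form_brk_adjoint[of b "minus_part a + a" d] form_brk[of a "minus_part b" d]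
    by (simp add: form_left_simps lie.mult_add_left)
qed

lemma gd_algebra_dual:
  assumes "GDYBE scale mult brk r"
  shows "gd_algebra dual_scale (dual scale) (dual_mult scale mult r) (dual_brk scale brk r)"
proof -
  interpret RB: rota_baxter_gd_algebra scale UNIV mult brk 1 minus_part
    using assms GDYBE_iff_rota_baxter by simp
  have vs: "vector_space (dual_scale :: 'k \<Rightarrow> ('a \<Rightarrow> 'k) \<Rightarrow> _)"
    by unfold_locales (auto simp: dual_scale_def fun_eq_iff algebra_simps)
  interpret D: vector_space "dual_scale :: 'k \<Rightarrow> ('a \<Rightarrow> 'k) \<Rightarrow> _" by (fact vs)
  interpret joint_embedding scale dual_scale "dual scale" "r_plus scale r" "r_minus scale r"
  proof unfold_locales
    show "D.subspace (dual scale)"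
      by (auto simp: D.subspace_def nov.dual_iff dual_scale_def algebra_simps)
    fix x y assume "x \<in> dual scale" "y \<in> dual scale" "r_plus scale r x = r_plus scale r y"
      "r_minus scale r x = r_minus scale r y"
    then show "x = y" by (metis I_G_def I_G_form dualE)
  qed (simp_all add: nov.r_plus_add nov.r_minus_add nov.r_plus_scale nov.r_minus_scale)
  show ?thesis
  proof (rule gd_algebra_pullback)
    show "gd_algebra scale UNIV mult brk" by unfold_locales
  qed (auto elim!: dualE simp: dual_mult_form dual_brk_form form_dual r_plus_form
      minus_part_def[symmetric] RB.rota_baxter_mult RB.rota_baxter_brk
      nov.mult_add_left nov.mult_add_right lie.mult_add_left lie.mult_add_right)
qed

end


section \<open>From factorizable bialgebras to Rota-Baxter algebras and back\<close>

lemma factorizable_imp_quadratic_rota_baxter: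
  assumes fact: "factorizable scale mult brk \<alpha> \<beta> r"
  defines "I_inv \<equiv> inv_into (dual scale) (I_G scale r)"
  shows "quadratic_rota_baxter_gd_algebra scale UNIV mult brk \<theta>
           (\<lambda>a. scale \<theta> (r_minus scale r (I_inv a))) I_inv"
proof -
  have quasi: "quasi_triangular scale mult brk \<alpha> \<beta> r"
    and bij: "bij_betw (I_G scale r) (dual scale) UNIV"
    using fact by (simp_all add: factorizable_def linear_iso_on_def)
  interpret gd_algebra scale UNIV mult brk
    using quasi by (simp add: quasi_triangular_def)
  have inv: "bij_betw I_inv UNIV (dual scale)"
    unfolding I_inv_def by (rule bij_betw_inv_into[OF bij])
  interpret tensor_with_form scale mult brk r I_inv
  proof unfold_locales
    show "range I_inv = dual scale" using inv by (simp add: bij_betw_def)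
    show "I_G scale r (I_inv a) = a" for a
      unfolding I_inv_def by (rule bij_betw_inv_into_right[OF bij UNIV_I])
  qed
  interpret quadratic_gd_algebra scale UNIV mult brk I_inv
    using quasi invariant_iff_quadratic by (simp add: quasi_triangular_def)
  interpret invariant_tensor scale mult brk r I_inv ..
  interpret RB: rota_baxter_gd_algebra scale UNIV mult brk 1 minus_part
    using quasi GDYBE_iff_rota_baxter by (simp add: quasi_triangular_def)
  have m: "r_minus scale r (I_inv a) = minus_part a" for a by (simp add: minus_part_def)
  show ?thesis
    unfolding m
  proof unfold_locales
    fix a b
    show "mult (scale \<theta> (minus_part a)) (scale \<theta> (minus_part b)) =
      scale \<theta> (minus_part (mult (scale \<theta> (minus_part a)) b + mult a (scale \<theta> (minus_part b))
        + scale \<theta> (mult a b)))"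
      using RB.rota_baxter_mult[of a b]
      by (simp add: nov.mult_scale_left nov.mult_scale_right minus_part_add minus_part_scale
          nov.scale_right_distrib)
    show "brk (scale \<theta> (minus_part a)) (scale \<theta> (minus_part b)) =
      scale \<theta> (minus_part (brk (scale \<theta> (minus_part a)) b + brk a (scale \<theta> (minus_part b))
        + scale \<theta> (brk a b)))"
      using RB.rota_baxter_brk[of a b]
      by (simp add: lie.mult_scale_left lie.mult_scale_right minus_part_add minus_part_scale
          nov.scale_right_distrib)
    show "I_inv (scale \<theta> (minus_part a)) b + I_inv a (scale \<theta> (minus_part b)) + \<theta> * I_inv a b = 0"
      using form_minus_part_right[of a b] unfolding form_left_simps form_right_simps by algebra
  qed (simp_all add: minus_part_add minus_part_scale nov.scale_right_distrib mult.commute)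
qed

text \<open>
  To count dimensions without giving the dual a basis, the functional \<open>form a\<close> is replaced by the
  vector with coordinates \<open>form a e\<close>. This gives an injective, hence surjective, endomorphism.
\<close>

lemma (in finite_dimensional_vector_space) nondegenerate_form_range:
  assumes left: "\<And>a. form a \<in> dual scale" and right: "\<And>b. (\<lambda>a. form a b) \<in> dual scale"
    and nondegenerate: "\<And>a. \<forall>b. form a b = 0 \<Longrightarrow> a = 0"
    and E: "finite E" "independent E" "span E = UNIV"
  shows "inj form" "range form = dual scale"
proof -
  define \<Phi> where "\<Phi> a = (\<Sum>e\<in>E. scale (form a e) e)" for a
  have determined: "x = y" if "x \<in> dual scale" "y \<in> dual scale" "\<forall>e\<in>E. x e = y e" for x y
  proof
    fix v
    have "v \<in> span E" using E by simp
    then show "x v = y v"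
      by (induction rule: span_induct_alt)
        (use that in \<open>simp_all add: dual_zero dual_add[OF that(1)] dual_add[OF that(2)]
           dual_homogeneous[OF that(1)] dual_homogeneous[OF that(2)]\<close>)
  qed
  have linear: "Vector_Spaces.linear scale scale \<Phi>"
    using right by unfold_locales
      (auto simp: \<Phi>_def dual_iff scale_left_distrib sum.distrib scale_sum_right)
  have coeff: "f e = g e" if "(\<Sum>e\<in>E. scale (f e) e) = (\<Sum>e\<in>E. scale (g e) e)" "e \<in> E" for f g e
  proof -
    have "(\<Sum>e\<in>E. scale (f e - g e) e) = 0"
      using that by (simp add: scale_left_diff_distrib sum_subtractf)
    then have "f e - g e = 0"
      using independentD[OF E(2) E(1) subset_refl, of "\<lambda>e. f e - g e" e] that by simp
    then show ?thesis by simp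
  qed
  show inj: "inj form"
  proof (rule injI)
    fix a b assume eq: "form a = form b"
    have "form (a - b) c = 0" for c
      using eq dual_diff[OF right[of c], of a b] by simp
    then show "a = b" using nondegenerate[of "a - b"] by simp
  qed
  have "inj \<Phi>"
    using coeff determined[OF left left] inj by (auto simp: inj_def \<Phi>_def)
  then have "surj \<Phi>" using linear_inj_imp_surj[OF linear] by simp
  show "range form = dual scale"
  proof
    show "range form \<subseteq> dual scale" using left by blast
    show "dual scale \<subseteq> range form"
    proof
      fix x assume x: "x \<in> dual scale"
      obtain a where "\<Phi> a = (\<Sum>e\<in>E. scale (x e) e)" using \<open>surj \<Phi>\<close> by (metis surjD)
      then have "form a = x" using coeff determined[OF left x] by (auto simp: \<Phi>_def)
      then show "x \<in> range form" by blast
    qed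
  qed
qed

text \<open>
  With \<open>d e = I(e\<^sup>*)\<close>, the value of \<open>r\<^sub>+\<close> comes from the expansion of \<open>a\<close> in the vectors \<open>d e\<close> with
  coordinates \<open>(a, e)\<close>. For \<open>r\<^sub>-\<close>, \<open>B + \<theta> id\<close> is adjoint to \<open>- B\<close>, so that \<open>form a\<close> has the value
  \<open>\<langle>e\<^sup>*, - B a\<rangle>\<close> at \<open>(B + \<theta> id) (d e)\<close>, and the sum is the expansion of \<open>B a\<close> in the basis.
\<close>

lemma (in quadratic_rota_baxter_gd_algebra) rota_baxter_r_contractions:
  assumes V: "V = UNIV" and inj: "inj form" and range: "range form = dual scale"
    and \<theta>: "\<theta> \<noteq> 0" and es: "distinct es" "nov.independent (set es)" "nov.span (set es) = UNIV"
  defines "r \<equiv> rota_baxter_r scale \<theta> B form es"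
  shows "r_minus scale r (form a) = scale (1 / \<theta>) (B a)"
    and "r_plus scale r (form a) = scale (1 / \<theta>) (B a) + a"
proof -
  let ?dv = "dual_basis_vector scale (set es)"
  define d where "d e = induced_iso form (?dv e)" for e
  have form_dual: "form a \<in> dual scale" for a using range by blast
  have form_left: "(\<lambda>a. form a b) \<in> dual scale" for b
    using form_add form_scale V by (simp add: nov.dual_iff)
  have dv: "?dv e \<in> dual scale" for e
    using es nov.representation_add[OF es(2)] nov.representation_scale[OF es(2)]
    by (simp add: nov.dual_iff dual_basis_vector_def)
  have form_d: "form (d e) = ?dv e" for e
    using dv[of e] range unfolding d_def induced_iso_def by (metis f_inv_into_f)
  have expand: "(\<Sum>e\<leftarrow>es. scale (?dv e v) e) = v" for v
    using es nov.sum_representation_eq[OF es(2), of v "set es"]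
    by (simp add: dual_basis_vector_def sum_list_distinct_conv_sum_set)
  have expand_d: "(\<Sum>e\<leftarrow>es. scale (form a e) (d e)) = a" for a
  proof (rule injD[OF inj], rule ext)
    fix b
    have "form (\<Sum>e\<leftarrow>es. scale (form a e) (d e)) b = form a (\<Sum>e\<leftarrow>es. scale (?dv e b) e)"
      by (simp add: nov.dual_sum_list[OF form_left] nov.dual_sum_list[OF form_dual] form_d mult.commute)
    then show "form (\<Sum>e\<leftarrow>es. scale (form a e) (d e)) b = form a b" by (simp add: expand)
  qed
  have r: "r = map (\<lambda>e. (scale (1 / \<theta>) e, B (d e) + scale \<theta> (d e))) es"
    by (simp add: r_def rota_baxter_r_def d_def Let_def)
  have "form a (B (d e) + scale \<theta> (d e)) = - ?dv e (B a)" for e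
    using form_B[of a "d e"] form_sym[of "B a" "d e"] V
    by (simp add: nov.dual_add[OF form_dual] nov.dual_homogeneous[OF form_dual] form_d
        eq_neg_iff_add_eq_0 algebra_simps)
  then have "r_minus scale r (form a) = - (\<Sum>e\<leftarrow>es. scale (1 / \<theta>) (scale (- ?dv e (B a)) e))"
    by (simp add: r r_minus_def comp_def mult.commute)
  also have "\<dots> = scale (1 / \<theta>) (\<Sum>e\<leftarrow>es. scale (?dv e (B a)) e)"
  proof -
    have "- (\<Sum>e\<leftarrow>xs. scale (1 / \<theta>) (scale (- f e) e)) = scale (1 / \<theta>) (\<Sum>e\<leftarrow>xs. scale (f e) e)"
      for f xs
      by (induction xs) (simp_all add: nov.scale_right_distrib)
    then show ?thesis .
  qed
  finally show "r_minus scale r (form a) = scale (1 / \<theta>) (B a)" by (simp add: expand)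
  have "r_plus scale r (form a) =
      (\<Sum>e\<leftarrow>es. scale (form a e / \<theta>) (B (d e) + scale \<theta> (d e)))"
    by (simp add: r r_plus_def comp_def nov.dual_homogeneous[OF form_dual])
  also have "\<dots> = scale (1 / \<theta>) (B (\<Sum>e\<leftarrow>es. scale (form a e) (d e))) + (\<Sum>e\<leftarrow>es. scale (form a e) (d e))"
  proof (induction es)
    case Nil
    show ?case using B_scale[of 0 0] V by simp
  next
    case (Cons e es)
    then show ?case
      using B_add B_scale \<theta> V by (simp add: nov.scale_right_distrib)
  qed
  finally show "r_plus scale r (form a) = scale (1 / \<theta>) (B a) + a" by (simp add: expand_d)
qed

lemma quadratic_rota_baxter_imp_factorizable:
  assumes fin_dim: "finite_dimensional_vector_space scale Basis"
    and quad: "quadratic_rota_baxter_gd_algebra scale UNIV mult brk \<theta> B form"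
    and \<theta>: "\<theta> \<noteq> 0"
    and es: "distinct es" "\<not> module.dependent scale (set es)" "module.span scale (set es) = UNIV"
  defines "r \<equiv> rota_baxter_r scale \<theta> B form es"
  shows "GDYBE scale mult brk r"
    and "factorizable scale mult brk (alpha_r scale mult r) (beta_r scale brk r) r"
proof -
  interpret finite_dimensional_vector_space scale Basis by (fact fin_dim)
  interpret Q: quadratic_rota_baxter_gd_algebra scale UNIV mult brk \<theta> B form by (fact quad)
  have left: "(\<lambda>a. form a b) \<in> dual scale" for b
    using Q.form_add Q.form_scale by (simp add: dual_iff)
  have right: "form a \<in> dual scale" for a
    using left[of a] Q.form_sym by (simp add: dual_iff)
  note range = nondegenerate_form_range[where form = form, OF right left _ finite_set es(2,3)]
  have inj: "inj form" and ran: "range form = dual scale"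
    using range Q.form_nondegenerate by auto
  note contractions = Q.rota_baxter_r_contractions[OF refl inj ran \<theta> es, folded r_def]
  interpret tensor_with_form scale mult brk r form
    using ran by unfold_locales (simp_all add: I_G_def contractions)
  interpret invariant_tensor scale mult brk r form ..
  have m: "minus_part a = scale (1 / \<theta>) (B a)" for a
    by (simp add: minus_part_def contractions)
  have "rota_baxter_gd_algebra scale UNIV mult brk 1 minus_part"
  proof unfold_locales
    fix a b
    have B: "B x = scale \<theta> (minus_part x)" for x using \<theta> by (simp add: m)
    show "mult (minus_part a) (minus_part b)
        = minus_part (mult (minus_part a) b + mult a (minus_part b) + scale 1 (mult a b))"
      using Q.rota_baxter_mult[of a b] \<theta>
      unfolding B by (simp add: Q.nov.mult_scale_left Q.nov.mult_scale_right
          scale_right_distrib[symmetric] minus_part_scale)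
    show "brk (minus_part a) (minus_part b)
        = minus_part (brk (minus_part a) b + brk a (minus_part b) + scale 1 (brk a b))"
      using Q.rota_baxter_brk[of a b] \<theta>
      unfolding B by (simp add: Q.lie.mult_scale_left Q.lie.mult_scale_right
          scale_right_distrib[symmetric] minus_part_scale)
  qed (simp_all add: minus_part_add minus_part_scale)
  then show GDYBE: "GDYBE scale mult brk r" by (simp add: GDYBE_iff_rota_baxter)
  have "linear_iso_on dual_scale (dual scale) scale UNIV (I_G scale r)"
    unfolding linear_iso_on_def
  proof (intro conjI ballI allI)
    show "bij_betw (I_G scale r) (dual scale) UNIV"
      by (rule bij_betw_byWitness[where f' = form]) (auto simp: I_G_form form_dual elim: dualE)
  qed (simp_all add: I_G_def r_plus_add r_minus_add r_plus_scale r_minus_scale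
      scale_right_diff_distrib)
  then show "factorizable scale mult brk (alpha_r scale mult r) (beta_r scale brk r) r"
    using GDYBE gd_algebra_dual invariant_iff_quadratic Q.gd_algebra_axioms
      Q.quadratic_gd_algebra_axioms
    by (simp add: factorizable_def quasi_triangular_def)
qed

theorem theorem4p15:
  fixes scale :: "'k::field_char_0 \<Rightarrow> 'a::ab_group_add \<Rightarrow> 'a"
    and Basis :: "'a set"
    and mult brk :: "'a \<Rightarrow> 'a \<Rightarrow> 'a"
  assumes fin_dim: "finite_dimensional_vector_space scale Basis"
  shows
    "(\<forall>(r :: 'a tensor_rep) (\<theta> :: 'k).
        factorizable scale mult brk (alpha_r scale mult r) (beta_r scale brk r) r \<longrightarrow>
        (let I_inv = inv_into (dual scale) (I_G scale r) in
         quadratic_rota_baxter_gd_algebra scale UNIV mult brk \<theta>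
           (\<lambda>a. scale \<theta> (r_minus scale r (I_inv a)))
           (\<lambda>a b. I_inv a b)))
     \<and>
     (\<forall>(\<theta> :: 'k) (B :: 'a \<Rightarrow> 'a) (form :: 'a \<Rightarrow> 'a \<Rightarrow> 'k) (es :: 'a list).
        quadratic_rota_baxter_gd_algebra scale UNIV mult brk \<theta> B form \<longrightarrow>
        \<theta> \<noteq> 0 \<longrightarrow>
        distinct es \<longrightarrow> \<not> module.dependent scale (set es) \<longrightarrow>
        module.span scale (set es) = UNIV \<longrightarrow>
        (let r = rota_baxter_r scale \<theta> B form es in
         GDYBE scale mult brk r \<and>
         factorizable scale mult brk (alpha_r scale mult r) (beta_r scale brk r) r))"
  unfolding Let_def
  using factorizable_imp_quadratic_rota_baxter quadratic_rota_baxter_imp_factorizable[OF fin_dim]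
  by blast

end
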